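(* Let $G$ be a graph with adjacency matrix $A(G)$, and let $C(G):=\operatorname{diag}(c(v))_{v\in V(G)}$. Then for any $x\in S$, \[ x^\top (I + C(G) + A(G))\,x \ge \frac{2}{\alpha(G)}. \] Moreover, let $x\in S$ and let $H_1,\ldots,H_k$ $(k\ge 1)$ denote the connected components of the induced subgraph $G[\operatorname{supp}(x)]$. Then \[x^\top (I + C(G) + A(G))\,x = \frac{2}{\alpha(G)}\] if and only if all of the following hold: (i) $\alpha(G) = \alpha(G[\operatorname{supp}(x)]) = \sum_{i=1}^k \alpha(H_i)$; (ii) for all $1\le i\le k$, $c_G(v) = c_{H_i}(v) = \omega(H_i)$ for all $v\in V(H_i)$; (iii) for all $1\le i\le k$, there exists $d_i$ such that $H_i$ is $d_i$-regular and $\alpha(H_i)(d_i+\omega(H_i)+1)=2|H_i|$; (iv) for all $1\le i\le k$ and all $v\in V(H_i)$, \[x_v=\frac{\alpha(H_i)}{\alpha(G)\,|H_i|}.\]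
   Context: Graphs are finite, simple and have a nonempty vertex set. For a graph $G$: $\alpha(G)$ is the independence number and $\omega(G)$ the clique number. For a vertex $v$ of $G$, $c(v)=c_G(v)$ is the number of vertices in a largest clique of $G$ containing $v$; for a subgraph $H$ of $G$ and $v\in V(H)$, $c_H(v)$ is the same quantity computed in $H$. $|H|$ denotes the number of vertices of $H$. $S$ is the standard simplex \[S=\Big\{x=(x_v)_{v\in V(G)}\in\mathbb{R}^{V(G)} : \sum_{v\in V(G)}x_v=1,\ x_v\ge 0 \text{ for all } v\in V(G)\Big\},\] and $\operatorname{supp}(x)=\{v\in V(G): x_v\ne 0\}$. $I$ is the identity matrix. *)

theory Defs
  imports
    "HOL-Analysis.Analysis"
    "Graph_Theory.Graph_Theory"
begin

text \<open>
  A simple graph is a symmetric digraph in the sense of the locale \<^locale>\<open>graph\<close>, which asks for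
  finitely many vertices and arcs and excludes loops and parallel arcs: an edge between \<open>u\<close> and \<open>v\<close>
  is the pair of opposite arcs from \<open>u\<close> to \<open>v\<close> and from \<open>v\<close> to \<open>u\<close>. Thus the degree of a vertex is
  its \<^const>\<open>out_degree\<close>.
\<close>

definition clique :: "('a, 'b) pre_digraph \<Rightarrow> 'a set \<Rightarrow> bool" where
  "clique G K \<longleftrightarrow> K \<subseteq> verts G \<and> (\<forall>u\<in>K. \<forall>v\<in>K. u \<noteq> v \<longrightarrow> u \<rightarrow>\<^bsub>G\<^esub> v)"

definition independent_set :: "('a, 'b) pre_digraph \<Rightarrow> 'a set \<Rightarrow> bool" where
  "independent_set G K \<longleftrightarrow> K \<subseteq> verts G \<and> (\<forall>u\<in>K. \<forall>v\<in>K. \<not> u \<rightarrow>\<^bsub>G\<^esub> v)"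

definition clique_number :: "('a, 'b) pre_digraph \<Rightarrow> nat" where
  "clique_number G = Max {card K |K. clique G K}"

definition independence_number :: "('a, 'b) pre_digraph \<Rightarrow> nat" where
  "independence_number G = Max {card K |K. independent_set G K}"

text \<open>Meaningful for \<open>v \<in> verts G\<close> only (otherwise the maximum is over the empty set).\<close>
definition clique_number_at :: "('a, 'b) pre_digraph \<Rightarrow> 'a \<Rightarrow> nat" where
  "clique_number_at G v = Max {card K |K. clique G K \<and> v \<in> K}"

definition regular_graph :: "nat \<Rightarrow> ('a, 'b) pre_digraph \<Rightarrow> bool" where
  "regular_graph d G \<longleftrightarrow> (\<forall>v\<in>verts G. out_degree G v = d)"

text \<open>
  \<^const>\<open>Digraph_Component.connected\<close> requires a nonempty vertex set, so the empty subgraph is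
  never a component.
\<close>
definition components_of_graph :: "('a, 'b) pre_digraph \<Rightarrow> ('a, 'b) pre_digraph set" where
  "components_of_graph G = {H. pre_digraph.max_subgraph G Digraph_Component.connected H}"

definition adjacency_matrix :: "('n::finite, 'b) pre_digraph \<Rightarrow> real ^ 'n ^ 'n" where
  "adjacency_matrix G = (\<chi> u v. if u \<rightarrow>\<^bsub>G\<^esub> v then 1 else 0)"

definition clique_matrix :: "('n::finite, 'b) pre_digraph \<Rightarrow> real ^ 'n ^ 'n" where
  "clique_matrix G = (\<chi> u v. if u = v then real (clique_number_at G u) else 0)"

definition standard_simplex :: "(real ^ 'n) set" where
  "standard_simplex = {x. (\<Sum>v\<in>UNIV. x $ v) = 1 \<and> (\<forall>v. 0 \<le> x $ v)}"

definition supp :: "real ^ 'n \<Rightarrow> 'n set" where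
  "supp x = {v. x $ v \<noteq> 0}"

end

theory Submission
  imports Defs
begin

text \<open>
  Let \<open>M = I + C(G) + A(G)\<close>, let \<open>x\<close> be a nonnegative weighting of the vertices, and let \<open>I\<close> be an
  independent set of maximum size that has maximum weight among these. The vertices outside \<open>I\<close> whose
  only neighbour in \<open>I\<close> is \<open>v\<close> form a clique together with \<open>v\<close>, and none of them is heavier than
  \<open>v\<close>: otherwise an exchange would improve \<open>I\<close>. All other vertices outside \<open>I\<close> have at least two
  neighbours in \<open>I\<close>. Counting gives \<open>\<Sum>v\<in>I. (M x) v \<ge> 2 * (\<Sum>v. x v)\<close>. At a minimizer of
  \<open>x \<bullet> M x\<close> on the simplex, \<open>M x\<close> is constant on the support and equal to the minimum, so this
  inequality in the graph induced on the support is the required bound.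

  In the equality case the counting is tight for every choice of \<open>I\<close>. Exchanging \<open>v\<close> with a vertex
  attached to it alone gives further sets \<open>I\<close>, which reach all vertices and show that the weight and
  the clique number do not change along edges. The same inequality in each component, summed over the
  components, is again tight, which gives the formulas for the degree and the weight.
\<close>

unbundle no funcset_syntax

section \<open>Cliques and independent sets\<close>

lemma (in graph) finite_clique_cards: "finite {card K |K. clique G K \<and> P K}"
proof -
  have "finite {K. clique G K}"
    by (rule finite_subset[of _ "Pow (verts G)"]) (auto simp: clique_def)
  then show ?thesis by (simp add: setcompr_eq_image)
qed

lemma (in graph) finite_independent_cards: "finite {card K |K. independent_set G K}"
proof -
  have "finite {K. independent_set G K}"
    by (rule finite_subset[of _ "Pow (verts G)"]) (auto simp: independent_set_def)
  then show ?thesis by (simp add: setcompr_eq_image)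
qed

lemma (in graph) card_le_clique_number_at:
  "clique G K \<Longrightarrow> v \<in> K \<Longrightarrow> card K \<le> clique_number_at G v"
  unfolding clique_number_at_def by (rule Max_ge[OF finite_clique_cards]) blast

lemma (in graph) clique_number_at_attained:
  assumes "v \<in> verts G"
  obtains K where "clique G K" "v \<in> K" "card K = clique_number_at G v"
proof -
  have "clique G {v}" using assms by (auto simp: clique_def)
  then have "{card K |K. clique G K \<and> v \<in> K} \<noteq> {}" by blast
  from Max_in[OF finite_clique_cards this] show ?thesis
    using that unfolding clique_number_at_def by auto
qed

lemma (in graph) card_le_clique_number: "clique G K \<Longrightarrow> card K \<le> clique_number G"
  unfolding clique_number_def
  by (rule Max_ge) (use finite_clique_cards[of "\<lambda>_. True"] in auto)

lemma (in graph) clique_number_attained: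
  obtains K where "clique G K" "card K = clique_number G"
proof -
  have "clique G {}" by (auto simp: clique_def)
  then have "{card K |K. clique G K} \<noteq> {}" by blast
  from Max_in[OF _ this] show ?thesis
    using that finite_clique_cards[of "\<lambda>_. True"] unfolding clique_number_def by auto
qed

lemma (in graph) card_le_independence_number:
  "independent_set G I \<Longrightarrow> card I \<le> independence_number G"
  unfolding independence_number_def by (rule Max_ge[OF finite_independent_cards]) blast

lemma (in graph) independence_number_attained:
  obtains I where "independent_set G I" "card I = independence_number G"
proof -
  have "independent_set G {}" by (auto simp: independent_set_def)
  then have "{card K |K. independent_set G K} \<noteq> {}" by blast
  from Max_in[OF finite_independent_cards this] show ?thesis
    using that unfolding independence_number_def by auto
qed

lemma (in graph) independence_number_pos:
  assumes "verts G \<noteq> {}" shows "0 < independence_number G"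
proof -
  from assms obtain v where "v \<in> verts G" by blast
  then have "independent_set G {v}" by (auto simp: independent_set_def dest: adj_not_same)
  from card_le_independence_number[OF this] show ?thesis by simp
qed

lemma (in graph) adj_sym: "u \<rightarrow> v \<longleftrightarrow> v \<rightarrow> u"
  using graph_symmetric by blast

lemma (in graph) finite_independent: "independent_set G I \<Longrightarrow> finite I"
  unfolding independent_set_def using finite_subset[OF _ finite_verts] by blast

section \<open>Heaviest maximum independent sets\<close>

text \<open>For a maximum independent set \<open>I\<close> and \<open>v \<in> I\<close> these are
  exactly the vertices outside \<open>I\<close> that can replace \<open>v\<close>.\<close>

definition (in pre_digraph) private_nbrs :: "'a set \<Rightarrow> 'a \<Rightarrow> 'a set" where
  "private_nbrs I v = {u \<in> verts G - I. {t \<in> I. u \<rightarrow> t} = {v}}"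

text \<open>Size comes first and weight second: maximum size yields cliques and domination, and
  maximum weight among the sets of that size yields the comparison of weights.\<close>

definition (in pre_digraph) heaviest :: "('a \<Rightarrow> real) \<Rightarrow> 'a set \<Rightarrow> bool" where
  "heaviest w I \<longleftrightarrow> independent_set G I \<and> card I = independence_number G
    \<and> (\<forall>J. independent_set G J \<and> card J = independence_number G \<longrightarrow> sum w J \<le> sum w I)"

text \<open>The entry at \<open>v\<close> of \<open>(I + diag k + A(G)) w\<close>.\<close>
definition (in pre_digraph) load :: "('a \<Rightarrow> nat) \<Rightarrow> ('a \<Rightarrow> real) \<Rightarrow> 'a \<Rightarrow> real" where
  "load k w v = (real (k v) + 1) * w v + (\<Sum>u | u \<in> verts G \<and> v \<rightarrow> u. w u)"

context graph
begin

lemma heaviest_exists: obtains I where "heaviest w I"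
proof -
  let ?S = "{I. independent_set G I \<and> card I = independence_number G}"
  have "finite ?S"
    by (rule finite_subset[of _ "Pow (verts G)"]) (auto simp: independent_set_def)
  then have fin: "finite (sum w ` ?S)" by (rule finite_imageI)
  have "?S \<noteq> {}" using independence_number_attained by auto
  then have "Max (sum w ` ?S) \<in> sum w ` ?S" using Max_in[OF fin] by simp
  then obtain I where I: "I \<in> ?S" and "Max (sum w ` ?S) = sum w I" by (rule imageE)
  then have "sum w J \<le> sum w I" if "J \<in> ?S" for J
    using Max_ge[OF fin imageI[OF that]] by simp
  then have "heaviest w I" using I by (simp add: heaviest_def)
  then show ?thesis by (rule that)
qed

text \<open>After the swap \<open>u\<close> has no neighbour left in the set, because
  \<open>v\<close> was its only one.\<close>

lemma exchange:
  assumes I: "independent_set G I" and v: "v \<in> I" and u: "u \<in> private_nbrs I v"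
  shows "independent_set G (insert u (I - {v}))" "card (insert u (I - {v})) = card I"
proof -
  have "u \<in> verts G" "u \<notin> I" and *: "{t \<in> I. u \<rightarrow> t} = {v}"
    using u by (auto simp: private_nbrs_def)
  have "\<not> u \<rightarrow> t" "\<not> t \<rightarrow> u" if "t \<in> I - {v}" for t
    using * that adj_sym[of u t] by auto
  then show "independent_set G (insert u (I - {v}))"
    using I \<open>u \<in> verts G\<close> adj_not_same unfolding independent_set_def by blast
  show "card (insert u (I - {v})) = card I"
    using card_Suc_Diff1[OF finite_independent[OF I] v] finite_independent[OF I] \<open>u \<notin> I\<close> by simp
qed

text \<open>Two nonadjacent private neighbours of \<open>v\<close> could replace \<open>v\<close>
  together, giving an independent set with one vertex too many.\<close>

lemma clique_private_nbrs:
  assumes I: "independent_set G I" "card I = independence_number G" and v: "v \<in> I"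
  shows "clique G (insert v (private_nbrs I v))"
proof -
  have vu: "u \<rightarrow> v" "v \<rightarrow> u" "u \<in> verts G" "u \<notin> I" if "u \<in> private_nbrs I v" for u
    using that adj_sym[of u v] by (auto simp: private_nbrs_def)
  have "u \<rightarrow> u'" if u: "u \<in> private_nbrs I v" and u': "u' \<in> private_nbrs I v" and "u \<noteq> u'" for u u'
  proof (rule ccontr)
    assume non: "\<not> u \<rightarrow> u'"
    let ?J = "insert u' (insert u (I - {v}))"
    have "\<not> u' \<rightarrow> t" "\<not> t \<rightarrow> u'" if "t \<in> I - {v}" for t
      using u' that adj_sym[of u' t] by (auto simp: private_nbrs_def)
    moreover have "\<not> u' \<rightarrow> u" using non adj_sym by blast
    ultimately have "independent_set G ?J"
      using exchange(1)[OF I(1) v u] non vu[OF u'] adj_not_same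
      unfolding independent_set_def by blast
    moreover have "card ?J = Suc (card I)"
      using exchange(2)[OF I(1) v u] finite_independent[OF I(1)] vu[OF u'] \<open>u \<noteq> u'\<close>
      by (subst card_insert_disjoint) auto
    ultimately show False using card_le_independence_number[of ?J] I(2) by simp
  qed
  then show ?thesis
    using vu v I(1) unfolding clique_def independent_set_def by blast
qed

lemma card_private_nbrs:
  assumes I: "independent_set G I" "card I = independence_number G" and v: "v \<in> I"
  shows "card (private_nbrs I v) + 1 \<le> clique_number_at G v"
proof -
  have "finite (private_nbrs I v)" "v \<notin> private_nbrs I v"
    using v by (auto simp: private_nbrs_def)
  then show ?thesis
    using card_le_clique_number_at[OF clique_private_nbrs[OF assms]] by simp
qed

lemma heaviest_private_le:
  assumes I: "heaviest w I" and v: "v \<in> I" and u: "u \<in> private_nbrs I v"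
  shows "w u \<le> w v"
proof -
  have ind: "independent_set G I" "card I = independence_number G"
    using I by (auto simp: heaviest_def)
  have "sum w (insert u (I - {v})) \<le> sum w I"
    using I exchange[OF ind(1) v u] unfolding heaviest_def by simp
  moreover have "u \<notin> I" using u by (simp add: private_nbrs_def)
  ultimately show ?thesis
    using finite_independent[OF ind(1)] v by (simp add: sum_diff1)
qed

lemma heaviest_exchange:
  assumes I: "heaviest w I" and v: "v \<in> I" and u: "u \<in> private_nbrs I v" and eq: "w u = w v"
  shows "heaviest w (insert u (I - {v}))"
proof -
  have ind: "independent_set G I" using I by (auto simp: heaviest_def)
  have "u \<notin> I" using u by (simp add: private_nbrs_def)
  then have "sum w (insert u (I - {v})) = sum w I"
    using finite_independent[OF ind] v eq by (simp add: sum_diff1)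
  then show ?thesis using I exchange[OF ind v u] by (simp add: heaviest_def)
qed

section \<open>Double counting around a maximum independent set\<close>

lemma maximum_independent_dominates:
  assumes I: "independent_set G I" "card I = independence_number G" and u: "u \<in> verts G - I"
  shows "0 < card {t \<in> I. u \<rightarrow> t}"
proof (rule ccontr)
  assume "\<not> ?thesis"
  then have "\<not> u \<rightarrow> t" "\<not> t \<rightarrow> u" if "t \<in> I" for t
    using that finite_independent[OF I(1)] adj_sym[of u t] by auto
  then have "independent_set G (insert u I)"
    using I(1) u adj_not_same unfolding independent_set_def by blast
  from card_le_independence_number[OF this] show False
    using I finite_independent[OF I(1)] u by simp
qed

text \<open>Summing the loads over \<open>I\<close> counts an outside vertex \<open>u\<close> once
  per neighbour in \<open>I\<close>, that is \<open>d u\<close> times. The weight of the vertices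
  with \<open>d u = 1\<close> is moved into the first sum, to be paid for there by the clique
  numbers.\<close>

lemma sum_load_eq:
  assumes I: "independent_set G I"
  defines "d \<equiv> \<lambda>u. card {t \<in> I. u \<rightarrow> t}"
  shows "(\<Sum>v\<in>I. load k w v) - 2 * sum w (verts G)
    = (\<Sum>v\<in>I. (real (k v) - 1) * w v - sum w (private_nbrs I v))
      + (\<Sum>u\<in>verts G - I. (real (d u) - 2 + (if d u = 1 then 1 else 0)) * w u)"
proof -
  have fin: "finite I" and sub: "I \<subseteq> verts G"
    using I finite_independent by (auto simp: independent_set_def)
  have "(\<Sum>v\<in>I. \<Sum>u | u \<in> verts G \<and> v \<rightarrow> u. w u) = (\<Sum>u\<in>verts G. \<Sum>v | v \<in> I \<and> v \<rightarrow> u. w u)"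
    by (rule sum.swap_restrict) (auto simp: fin)
  also have "\<dots> = (\<Sum>u\<in>verts G. real (d u) * w u)"
    using adj_sym by (intro sum.cong) (auto simp: d_def)
  also have "\<dots> = (\<Sum>u\<in>verts G - I. real (d u) * w u)"
  proof (rule sum.mono_neutral_right)
    show "\<forall>u\<in>verts G - (verts G - I). real (d u) * w u = 0"
    proof
      fix u assume "u \<in> verts G - (verts G - I)"
      then have "{t \<in> I. u \<rightarrow> t} = {}" using I by (auto simp: independent_set_def)
      then have "d u = 0" unfolding d_def by (simp only: card.empty)
      then show "real (d u) * w u = 0" by simp
    qed
  qed auto
  finally have nb: "(\<Sum>v\<in>I. \<Sum>u | u \<in> verts G \<and> v \<rightarrow> u. w u) = (\<Sum>u\<in>verts G - I. real (d u) * w u)" .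
  have "(\<Sum>v\<in>I. sum w (private_nbrs I v))
      = (\<Sum>v\<in>I. \<Sum>u | u \<in> verts G - I \<and> {t \<in> I. u \<rightarrow> t} = {v}. w u)"
    by (simp add: private_nbrs_def)
  also have "\<dots> = (\<Sum>u\<in>verts G - I. \<Sum>v | v \<in> I \<and> {t \<in> I. u \<rightarrow> t} = {v}. w u)"
    by (rule sum.swap_restrict) (auto simp: fin)
  also have "\<dots> = (\<Sum>u\<in>verts G - I. (if d u = 1 then 1 else 0) * w u)"
  proof (rule sum.cong[OF refl])
    fix u
    show "(\<Sum>v | v \<in> I \<and> {t \<in> I. u \<rightarrow> t} = {v}. w u) = (if d u = 1 then 1 else 0) * w u"
    proof (cases "d u = 1")
      case True
      then obtain s where s: "{t \<in> I. u \<rightarrow> t} = {s}" unfolding d_def by (rule card_1_singletonE)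
      then have "{v. v \<in> I \<and> {t \<in> I. u \<rightarrow> t} = {v}} = {s}" by blast
      then show ?thesis using True by simp
    next
      case False
      then have "{v. v \<in> I \<and> {t \<in> I. u \<rightarrow> t} = {v}} = {}" by (auto simp: d_def)
      then show ?thesis using False by (simp only: sum.empty) simp
    qed
  qed
  finally have pr: "(\<Sum>v\<in>I. sum w (private_nbrs I v))
    = (\<Sum>u\<in>verts G - I. (if d u = 1 then 1 else 0) * w u)" .
  have "sum w (verts G) = sum w I + sum w (verts G - I)"
    using sum.subset_diff[OF sub, of w] by simp
  then show ?thesis
    using nb pr by (simp add: load_def sum.distrib sum_subtractf algebra_simps sum_distrib_left)
qed

text \<open>The first bound compares weights, the second compares the number of private neighbours
  with the size of a clique. They are kept apart because equality in each carries different
  information in the tight case.\<close>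

lemma heaviest_private_slack:
  assumes I: "heaviest w I" and v: "v \<in> I" and w: "0 \<le> w v"
    and k: "clique_number_at G v \<le> k v"
  shows "sum w (private_nbrs I v) \<le> real (card (private_nbrs I v)) * w v"
    and "real (card (private_nbrs I v)) * w v \<le> (real (k v) - 1) * w v"
proof -
  show "sum w (private_nbrs I v) \<le> real (card (private_nbrs I v)) * w v"
    using heaviest_private_le[OF I v] by (intro sum_bounded_above) auto
  have "card (private_nbrs I v) + 1 \<le> k v"
    using card_private_nbrs[of I v] I v k by (simp add: heaviest_def)
  then show "real (card (private_nbrs I v)) * w v \<le> (real (k v) - 1) * w v"
    using w by (intro mult_right_mono) auto
qed

text \<open>All terms on the right of \<open>sum_load_eq\<close> are nonnegative, so in the tight
  case all of them vanish. The function \<open>k\<close> is only bounded from below, because it will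
  hold the clique numbers of a larger graph.\<close>

lemma
  assumes I: "heaviest w I"
    and w: "\<And>v. v \<in> verts G \<Longrightarrow> 0 \<le> w v"
    and k: "\<And>v. v \<in> verts G \<Longrightarrow> clique_number_at G v \<le> k v"
  shows sum_load_ge: "2 * sum w (verts G) \<le> (\<Sum>v\<in>I. load k w v)"
    and sum_load_tight:
      "(\<Sum>v\<in>I. load k w v) \<le> 2 * sum w (verts G) \<Longrightarrow>
        (\<forall>v\<in>I. sum w (private_nbrs I v) = (real (k v) - 1) * w v) \<and>
        (\<forall>u\<in>verts G - I. 0 < w u \<longrightarrow> card {t \<in> I. u \<rightarrow> t} \<le> 2)"
proof -
  define d where "d u = card {t \<in> I. u \<rightarrow> t}" for u
  have ind: "independent_set G I" "card I = independence_number G"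
    using I by (auto simp: heaviest_def)
  have sub: "I \<subseteq> verts G" and fin: "finite I"
    using ind finite_independent by (auto simp: independent_set_def)
  let ?a = "\<lambda>v. (real (k v) - 1) * w v - sum w (private_nbrs I v)"
  let ?b = "\<lambda>u. (real (d u) - 2 + (if d u = 1 then 1 else 0)) * w u"
  note eq = sum_load_eq[OF ind(1), of k w, folded d_def]
  have a: "0 \<le> ?a v" if "v \<in> I" for v
  proof -
    have "v \<in> verts G" using that sub by blast
    then show ?thesis using heaviest_private_slack[of w I v k] I that w k by force
  qed
  \<comment> \<open>Domination excludes \<open>d u = 0\<close>; for \<open>d u = 1\<close> the
    correction cancels \<open>1 - 2\<close>; otherwise \<open>d u - 2\<close> is
    nonnegative.\<close>
  have c: "0 \<le> real (d u) - 2 + (if d u = 1 then 1 else 0)" if "u \<in> verts G - I" for u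
    using maximum_independent_dominates[OF ind that] by (auto simp: d_def)
  have b: "0 \<le> ?b u" if "u \<in> verts G - I" for u
    using c[OF that] w that by (intro mult_nonneg_nonneg) auto
  have A: "0 \<le> sum ?a I" and B: "0 \<le> sum ?b (verts G - I)"
    using a b by (auto intro!: sum_nonneg)
  show "2 * sum w (verts G) \<le> (\<Sum>v\<in>I. load k w v)" using A B eq by linarith
  assume "(\<Sum>v\<in>I. load k w v) \<le> 2 * sum w (verts G)"
  then have "sum ?a I = 0" "sum ?b (verts G - I) = 0" using A B eq by linarith+
  then have "\<forall>v\<in>I. ?a v = 0" "\<forall>u\<in>verts G - I. ?b u = 0"
    using sum_nonneg_eq_0_iff[OF fin, of ?a] sum_nonneg_eq_0_iff[of "verts G - I" ?b] a b by auto
  moreover have "d u \<le> 2" if u: "u \<in> verts G - I" "0 < w u" for u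
  proof -
    have "?b u = 0" using calculation(2) u(1) by blast
    then have "real (d u) - 2 + (if d u = 1 then 1 else 0) = 0" using u(2) by simp
    then show ?thesis by (simp split: if_splits)
  qed
  ultimately show "(\<forall>v\<in>I. sum w (private_nbrs I v) = (real (k v) - 1) * w v) \<and>
        (\<forall>u\<in>verts G - I. 0 < w u \<longrightarrow> card {t \<in> I. u \<rightarrow> t} \<le> 2)"
    by (auto simp: d_def)
qed


end

section \<open>The tight case\<close>

text \<open>The equality case in abstract form. The reverse inequality is assumed for every heaviest
  set, since the arguments move between such sets by exchanges; positivity allows cancelling
  weights.\<close>

locale tight_graph = graph +
  fixes k :: "'a \<Rightarrow> nat" and w :: "'a \<Rightarrow> real"
  assumes w_pos: "v \<in> verts G \<Longrightarrow> 0 < w v"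
    and k_ge: "v \<in> verts G \<Longrightarrow> clique_number_at G v \<le> k v"
    and tight: "heaviest w I \<Longrightarrow> (\<Sum>v\<in>I. load k w v) \<le> 2 * sum w (verts G)"
begin

lemma heaviest_subset: "heaviest w I \<Longrightarrow> v \<in> I \<Longrightarrow> v \<in> verts G"
  by (auto simp: heaviest_def independent_set_def)

text \<open>Tightness equates the two ends of a chain: the weight of the private neighbours, their
  number times \<open>w v\<close>, \<open>(clique_number_at G v - 1) * w v\<close>, and
  \<open>(k v - 1) * w v\<close>. Each conclusion is equality in one link.\<close>

lemma
  assumes I: "heaviest w I" and v: "v \<in> I"
  shows tight_k: "k v = clique_number_at G v"
    and tight_card: "card (insert v (private_nbrs I v)) = clique_number_at G v"
    and tight_private: "u \<in> private_nbrs I v \<Longrightarrow> w u = w v"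
proof -
  have V: "v \<in> verts G" using heaviest_subset[OF I v] .
  have fin: "finite (private_nbrs I v)" "v \<notin> private_nbrs I v"
    using v by (auto simp: private_nbrs_def)
  have "sum w (private_nbrs I v) = (real (k v) - 1) * w v"
    using sum_load_tight[of w I k] I v w_pos k_ge tight[OF I] by (simp add: less_imp_le)
  \<comment> \<open>Instantiating with \<open>clique_number_at G\<close> instead of \<open>k\<close>
    places the clique number inside the chain.\<close>
  moreover note heaviest_private_slack(1)[of w I v "clique_number_at G"]
    heaviest_private_slack(2)[of w I v "clique_number_at G"]
  moreover have "(real (clique_number_at G v) - 1) * w v \<le> (real (k v) - 1) * w v"
    using k_ge[OF V] w_pos[OF V] by simp
  ultimately have
      s: "sum w (private_nbrs I v) = real (card (private_nbrs I v)) * w v" and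
      c: "real (card (private_nbrs I v)) * w v = (real (clique_number_at G v) - 1) * w v"
        "(real (clique_number_at G v) - 1) * w v = (real (k v) - 1) * w v"
    using I v w_pos[OF V] by auto
  from c w_pos[OF V] show "k v = clique_number_at G v" by simp
  from c(1) w_pos[OF V] have "real (card (private_nbrs I v)) = real (clique_number_at G v) - 1"
    by simp
  then show "card (insert v (private_nbrs I v)) = clique_number_at G v" using fin by simp
  have "(\<Sum>u\<in>private_nbrs I v. w v - w u) = 0" using s by (simp add: sum_subtractf)
  then have "\<forall>u\<in>private_nbrs I v. w v - w u = 0"
    using heaviest_private_le[OF I v] fin by (subst (asm) sum_nonneg_eq_0_iff) auto
  then show "w u = w v" if "u \<in> private_nbrs I v" using that by simp
qed

lemma tight_exchange:
  assumes I: "heaviest w I" and v: "v \<in> I" and u: "u \<in> private_nbrs I v"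
  shows "heaviest w (insert u (I - {v}))"
  using heaviest_exchange[OF I v u tight_private[OF I v u]] .

text \<open>The clique formed by \<open>v\<close> and its private neighbours is a largest one at
  \<open>v\<close> and contains \<open>u\<close>. After the swap \<open>v\<close> is in turn a
  private neighbour of \<open>u\<close>, which gives the opposite inequality.\<close>

lemma tight_private_clique_number:
  assumes I: "heaviest w I" and v: "v \<in> I" and u: "u \<in> private_nbrs I v"
  shows "clique_number_at G u = clique_number_at G v"
proof -
  have le: "clique_number_at G v \<le> clique_number_at G u"
    if "heaviest w I" "v \<in> I" "u \<in> private_nbrs I v" for I u v
  proof -
    have "clique G (insert v (private_nbrs I v))"
      using clique_private_nbrs[of I v] that by (simp add: heaviest_def)
    from card_le_clique_number_at[OF this, of u] show ?thesis
      using tight_card[OF that(1,2)] that(3) by simp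
  qed
  let ?J = "insert u (I - {v})"
  have "u \<notin> I" "u \<rightarrow> v" using u by (auto simp: private_nbrs_def)
  moreover from this have "u \<noteq> v" "v \<rightarrow> u" using v adj_sym by auto
  moreover have "\<not> v \<rightarrow> t" if "t \<in> I" for t
    using I v that by (auto simp: heaviest_def independent_set_def)
  ultimately have "v \<in> private_nbrs ?J u"
    using heaviest_subset[OF I v] unfolding private_nbrs_def by blast
  from le[OF tight_exchange[OF assms] _ this] le[OF assms] show ?thesis by simp
qed

text \<open>A private neighbour needs one exchange. Otherwise tightness leaves \<open>u\<close>
  exactly one further neighbour \<open>v'\<close> in \<open>I\<close>, and a suitable exchange at
  \<open>v'\<close> makes \<open>u\<close> private to \<open>v\<close>.\<close>

lemma tight_edge:
  assumes I: "heaviest w I" and v: "v \<in> I" and uv: "u \<rightarrow> v"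
  shows "w u = w v \<and> clique_number_at G u = clique_number_at G v \<and> (\<exists>J. heaviest w J \<and> u \<in> J)"
proof -
  have via_private: ?thesis if "heaviest w I" "v \<in> I" "u \<in> private_nbrs I v" for I
    using tight_private[OF that] tight_private_clique_number[OF that] tight_exchange[OF that] by blast
  show ?thesis
  proof (cases "u \<in> private_nbrs I v")
    case True
    then show ?thesis using via_private[OF I v] by blast
  next
    case False
    let ?N = "{t \<in> I. u \<rightarrow> t}"
    have ind: "independent_set G I" "card I = independence_number G"
      using I by (auto simp: heaviest_def)
    have "u \<notin> I" using ind uv v by (auto simp: independent_set_def)
    have uV: "u \<in> verts G" using uv adj_in_verts by blast
    have two: "card ?N \<le> 2"
      using sum_load_tight[of w I k] I w_pos k_ge tight[OF I] \<open>u \<notin> I\<close> uV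
      by (simp add: less_imp_le)
    have "v \<in> ?N" using v uv by blast
    moreover have "?N \<noteq> {v}" using False \<open>u \<notin> I\<close> uV by (simp add: private_nbrs_def)
    ultimately obtain v' where v': "v' \<in> ?N" "v' \<noteq> v" by blast
    have N: "?N = {v, v'}"
      using card_seteq[of ?N "{v, v'}"] two v' \<open>v \<in> ?N\<close> finite_independent[OF ind(1)] by simp
    have nP: "u \<notin> private_nbrs I v'" using N v'(2) by (auto simp: private_nbrs_def)
    let ?K = "insert v' (private_nbrs I v')"
    have K: "clique G ?K" using clique_private_nbrs[OF ind, of v'] v' by simp
    \<comment> \<open>\<open>u\<close> misses some \<open>z\<close> in the largest clique \<open>?K\<close> at \<open>v'\<close>; exchanging \<open>v'\<close> for \<open>z\<close> leaves \<open>v\<close> as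
      the only neighbour of \<open>u\<close>.\<close>
    have "\<exists>z\<in>?K. \<not> u \<rightarrow> z"
    proof (rule ccontr)
      assume "\<not> ?thesis"
      then have *: "u \<rightarrow> z" "z \<rightarrow> u" if "z \<in> ?K" for z using that adj_sym[of u z] by auto
      then have "clique G (insert u ?K)"
        using K uV unfolding clique_def by blast
      then have "card (insert u ?K) \<le> clique_number_at G v'"
        by (rule card_le_clique_number_at) simp
      moreover have "finite ?K" by (simp add: private_nbrs_def)
      moreover have "u \<notin> ?K" using nP v' \<open>u \<notin> I\<close> by auto
      ultimately show False using tight_card[OF I, of v'] v' by simp
    qed
    then obtain z where z: "z \<in> private_nbrs I v'" "\<not> u \<rightarrow> z" using v' by blast
    let ?J = "insert z (I - {v'})"
    have J: "heaviest w ?J" using tight_exchange[OF I _ z(1)] v' by blast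
    have "{t \<in> ?J. u \<rightarrow> t} = {v}" using N z(2) v'(2) v uv by blast
    moreover have "u \<notin> ?J" using \<open>u \<notin> I\<close> nP z(1) by auto
    ultimately have "u \<in> private_nbrs ?J v" using uV by (simp add: private_nbrs_def)
    moreover have "v \<in> ?J" using v v'(2) by blast
    ultimately show ?thesis using via_private[OF J] by blast
  qed
qed

text \<open>A heaviest set dominates all vertices outside it, so one application of
  \<open>tight_edge\<close> reaches \<open>u\<close>.\<close>

lemma in_some_heaviest:
  assumes "u \<in> verts G"
  obtains I where "heaviest w I" "u \<in> I"
proof -
  obtain I where I: "heaviest w I" by (rule heaviest_exists)
  show ?thesis
  proof (cases "u \<in> I")
    case True
    then show ?thesis using that I by blast
  next
    case False
    then have "0 < card {t \<in> I. u \<rightarrow> t}"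
      using maximum_independent_dominates[of I u] I assms by (simp add: heaviest_def)
    then obtain v where "v \<in> I" "u \<rightarrow> v" by (auto simp: card_gt_0_iff)
    then show ?thesis using tight_edge[OF I] that by blast
  qed
qed

lemma tight_k_eq: "v \<in> verts G \<Longrightarrow> k v = clique_number_at G v"
  using in_some_heaviest tight_k by metis

lemma tight_edge_eq:
  assumes "u \<rightarrow> v"
  shows "w u = w v" "clique_number_at G u = clique_number_at G v"
proof -
  have "v \<in> verts G" using assms adj_in_verts by blast
  then obtain I where "heaviest w I" "v \<in> I" by (rule in_some_heaviest)
  from tight_edge[OF this assms] show "w u = w v" "clique_number_at G u = clique_number_at G v"
    by auto
qed

end

section \<open>Components\<close>

lemma (in wf_digraph) strongly_connected_imp_connected:
  "strongly_connected G \<Longrightarrow> Digraph_Component.connected G"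
  by (rule connectedI) (auto simp: strongly_connected_def intro: reachable_mk_symmetricI)

text \<open>\<open>connected\<close> means weakly connected. In a symmetric digraph the maximal
  connected subgraphs are the strong components, which makes the facts about \<open>sccs\<close>
  available.\<close>

lemma (in graph) components_eq_sccs: "components_of_graph G = sccs"
proof -
  \<comment> \<open>Adding arcs on the same vertices keeps a digraph connected, so a maximal
    connected subgraph is induced.\<close>
  have mono: "arc_mono (Digraph_Component.connected :: ('a, 'b) pre_digraph \<Rightarrow> bool)"
    unfolding arc_mono_def
  proof (intro allI impI)
    fix H1 H2 :: "('a, 'b) pre_digraph"
    assume *: "Digraph_Component.connected H1 \<and> subgraph H1 H2 \<and> verts H1 = verts H2"
    then interpret H2: wf_digraph H2 by (simp add: subgraph_def)
    show "Digraph_Component.connected H2"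
      using * by (intro H2.connected_spanning_imp_connected[of H1]) (auto simp: spanning_def)
  qed
  \<comment> \<open>A subgraph may contain only one arc of an opposite pair; the subgraph induced on
    its vertices is symmetric, and there connected implies strongly connected.\<close>
  have strong: "strongly_connected (G \<restriction> verts H)"
    if "subgraph H G" "Digraph_Component.connected H" for H
  proof -
    have ind: "induced_subgraph (G \<restriction> verts H) G"
      using that(1) by (intro induced_induce) (auto simp: subgraph_def)
    then interpret I: sym_digraph "G \<restriction> verts H" by (rule induced_graph_imp_graph)
    have "Digraph_Component.connected (G \<restriction> verts H)"
      using mono that subgraph_induce_subgraphI2[OF that(1)]
      unfolding arc_mono_def by (metis induce_subgraph_verts)
    then show ?thesis
      using I.symmetric_connected_imp_strongly_connected I.sym_arcs by blast
  qed
  have connected_if_strong: "Digraph_Component.connected K"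
    if "subgraph K G" "strongly_connected K" for K
  proof -
    interpret K: wf_digraph K using that(1) by (simp add: subgraph_def)
    show ?thesis using that(2) by (rule K.strongly_connected_imp_connected)
  qed
  have "max_subgraph Digraph_Component.connected H \<longleftrightarrow> max_subgraph strongly_connected H" for H
  proof
    assume H: "max_subgraph Digraph_Component.connected H"
    have "induced_subgraph H G" by (rule induced_subgraphI_arc_mono[OF H mono])
    then have "G \<restriction> verts H = H" by (rule induce_eq_iff_induced)
    with strong[of H] H have "strongly_connected H" by (simp add: max_subgraph_def)
    then show "max_subgraph strongly_connected H"
      using H connected_if_strong unfolding max_subgraph_def by blast
  next
    assume H: "max_subgraph strongly_connected H"
    then have sH: "subgraph H G" by (simp add: max_subgraph_def)
    show "max_subgraph Digraph_Component.connected H"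
    proof (rule max_subgraphI)
      show "subgraph H G" by (rule sH)
      show "Digraph_Component.connected H"
        by (rule connected_if_strong[OF sH max_subgraph_prop[OF H]])
      fix H' assume H': "H \<noteq> H'" "subgraph H H'" "subgraph H' G"
      show "\<not> Digraph_Component.connected H'"
      proof
        assume con: "Digraph_Component.connected H'"
        \<comment> \<open>Maximality of \<open>H\<close> among strongly connected subgraphs gives
          \<open>?K = H\<close>, so \<open>H'\<close> lies between \<open>H\<close> and
          itself.\<close>
        let ?K = "G \<restriction> verts H'"
        have K: "subgraph H' ?K" using subgraph_induce_subgraphI2[OF H'(3)] .
        then have "subgraph H ?K" using H'(2) subgraph_trans by blast
        moreover have "subgraph ?K G"
          using H'(3) by (intro subgraph_induce_subgraphI) (auto simp: subgraph_def)
        ultimately have "?K = H" using H strong[OF H'(3) con] unfolding max_subgraph_def by blast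
        with K have "subgraph H' H" by simp
        with H'(2) have "verts H = verts H'" "arcs H = arcs H'" "tail H = tail H'" "head H = head H'"
          unfolding subgraph_def compatible_def by blast+
        then show False using H'(1) by (simp add: pre_digraph.equality)
      qed
    qed
  qed
  then show ?thesis by (simp add: components_of_graph_def sccs_altdef2)
qed

section \<open>Induced subgraphs and degrees\<close>

lemma (in wf_digraph) dominates_induce_iff: "u \<rightarrow>\<^bsub>G \<restriction> S\<^esub> v \<longleftrightarrow> u \<rightarrow> v \<and> u \<in> S \<and> v \<in> S"
  by (auto simp: arcs_ends_conv image_iff)

lemma (in graph) graph_induce:
  assumes "S \<subseteq> verts G" shows "graph (G \<restriction> S)"
proof -
  have ind: "induced_subgraph (G \<restriction> S) G" using assms by (rule induced_induce)
  interpret d: digraph "G \<restriction> S" using ind by (rule digraphI_induced)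
  interpret s: sym_digraph "G \<restriction> S" using ind by (rule induced_graph_imp_graph)
  show ?thesis by unfold_locales
qed

lemma (in graph) clique_induce_iff:
  "S \<subseteq> verts G \<Longrightarrow> clique (G \<restriction> S) K \<longleftrightarrow> clique G K \<and> K \<subseteq> S"
  by (auto simp: clique_def dominates_induce_iff)

lemma (in graph) independent_induce_iff:
  "S \<subseteq> verts G \<Longrightarrow> independent_set (G \<restriction> S) K \<longleftrightarrow> independent_set G K \<and> K \<subseteq> S"
  unfolding independent_set_def dominates_induce_iff induce_subgraph_verts by blast

lemma (in graph) clique_number_at_induce_le:
  assumes "S \<subseteq> verts G" "v \<in> S"
  shows "clique_number_at (G \<restriction> S) v \<le> clique_number_at G v"
proof -
  interpret S: graph "G \<restriction> S" using assms(1) by (rule graph_induce)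
  obtain K where "clique (G \<restriction> S) K" "v \<in> K" "card K = clique_number_at (G \<restriction> S) v"
    using S.clique_number_at_attained[of v] assms(2) by auto
  then show ?thesis
    using card_le_clique_number_at[of K v] clique_induce_iff[OF assms(1)] by simp
qed

lemma (in graph) independence_number_induce_le:
  assumes "S \<subseteq> verts G"
  shows "independence_number (G \<restriction> S) \<le> independence_number G"
proof -
  interpret S: graph "G \<restriction> S" using assms(1) by (rule graph_induce)
  obtain I where "independent_set (G \<restriction> S) I" "card I = independence_number (G \<restriction> S)"
    by (rule S.independence_number_attained)
  then show ?thesis
    using card_le_independence_number[of I] independent_induce_iff[OF assms(1)] by simp
qed

text \<open>Without parallel arcs, \<open>head G\<close> is injective on the arcs leaving
  \<open>v\<close>.\<close>

lemma (in graph) out_degree_eq: "out_degree G v = card {u \<in> verts G. v \<rightarrow> u}"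
proof -
  have "inj_on (head G) (out_arcs G v)"
    by (rule inj_onI) (auto simp: out_arcs_def arc_to_ends_def intro: no_multi_arcs)
  moreover have "head G ` out_arcs G v = {u \<in> verts G. v \<rightarrow> u}"
    by (auto simp: out_arcs_def arcs_ends_conv image_iff)
  ultimately show ?thesis using card_image[of "head G" "out_arcs G v"] by (simp add: out_degree_def)
qed

section \<open>Structure of components and additivity over them\<close>

text \<open>Closure under neighbours holds because an arc and its opposite make their ends mutually
  reachable, hence members of the same strong component.\<close>

lemma (in graph)
  assumes H: "H \<in> components_of_graph G"
  shows component_eq_induce: "H = G \<restriction> verts H"
    and component_graph: "graph H"
    and component_subset: "verts H \<subseteq> verts G"
    and component_nonempty: "verts H \<noteq> {}"
    and component_strongly_connected: "strongly_connected H"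
    and component_closed: "u \<in> verts H \<Longrightarrow> u \<rightarrow> v \<Longrightarrow> v \<in> verts H"
proof -
  have scc: "H \<in> sccs" using H components_eq_sccs by simp
  then have ind: "induced_subgraph H G" by (rule in_sccs_imp_induced)
  then show eq: "H = G \<restriction> verts H" by (simp add: induce_eq_iff_induced)
  show sub: "verts H \<subseteq> verts G" using ind by (auto simp: induced_subgraph_def subgraph_def)
  show "graph H" using graph_induce[OF sub] eq by simp
  show sc: "strongly_connected H" using scc by (simp add: sccs_def)
  then show "verts H \<noteq> {}" by (simp add: strongly_connected_def)
  assume u: "u \<in> verts H" and uv: "u \<rightarrow> v"
  have S: "verts H \<in> sccs_verts" using scc by (simp add: in_sccs_vertsI_sccs)
  have "u \<rightarrow>\<^sup>* v" "v \<rightarrow>\<^sup>* u" using uv graph_symmetric by blast+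
  then show "v \<in> verts H" using S u unfolding sccs_verts_def by blast
qed

lemma (in graph)
  shows finite_components: "finite (components_of_graph G)"
    and component_exists: "v \<in> verts G \<Longrightarrow> \<exists>H\<in>components_of_graph G. v \<in> verts H"
    and components_disjoint: "H \<in> components_of_graph G \<Longrightarrow> H' \<in> components_of_graph G \<Longrightarrow>
      H \<noteq> H' \<Longrightarrow> verts H \<inter> verts H' = {}"
proof -
  show "finite (components_of_graph G)"
    using finite_sccs_verts by (simp add: components_eq_sccs sccs_conv_sccs_verts)
  show "\<exists>H\<in>components_of_graph G. v \<in> verts H" if "v \<in> verts G"
    using induce_reachable_is_in_sccs[OF that] that
    by (intro bexI[of _ "G \<restriction> {u. v \<rightarrow>\<^sup>* u}"]) (auto simp: components_eq_sccs)
  show "H \<in> components_of_graph G \<Longrightarrow> H' \<in> components_of_graph G \<Longrightarrow>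
      H \<noteq> H' \<Longrightarrow> verts H \<inter> verts H' = {}"
    using scc_disj by (simp add: components_eq_sccs)
qed

lemma (in graph) sum_components:
  assumes "S \<subseteq> verts G"
  shows "sum f S = (\<Sum>H\<in>components_of_graph G. sum f (S \<inter> verts H))"
proof -
  let ?C = "components_of_graph G"
  have "sum f (\<Union>H\<in>?C. S \<inter> verts H) = (\<Sum>H\<in>?C. sum f (S \<inter> verts H))"
  proof (rule sum.UNION_disjoint[OF finite_components])
    show "\<forall>H\<in>?C. finite (S \<inter> verts H)"
      using finite_subset[OF assms finite_verts] by simp
    show "\<forall>H\<in>?C. \<forall>H'\<in>?C. H \<noteq> H' \<longrightarrow> (S \<inter> verts H) \<inter> (S \<inter> verts H') = {}"
      using components_disjoint by blast
  qed
  moreover have "(\<Union>H\<in>?C. S \<inter> verts H) = S"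
    using component_exists assms by blast
  ultimately show ?thesis by simp
qed

lemma (in graph) component_const:
  assumes H: "H \<in> components_of_graph G" and f: "\<And>u v. u \<rightarrow> v \<Longrightarrow> f u = f v"
    and "u \<in> verts H" "v \<in> verts H"
  shows "f u = f v"
proof -
  have "u \<rightarrow>\<^sup>*\<^bsub>H\<^esub> v"
    using component_strongly_connected[OF H] assms(3,4) by (simp add: strongly_connected_def)
  then have "u \<rightarrow>\<^sup>* v"
    using reachable_induce_subgraphD component_eq_induce[OF H] component_subset[OF H] by metis
  then show ?thesis by induct (simp_all add: f)
qed

text \<open>All other vertices of a clique through \<open>v\<close> are neighbours of
  \<open>v\<close>, so the clique stays in the component of \<open>v\<close>.\<close>

lemma (in graph) component_clique_number_at:
  assumes H: "H \<in> components_of_graph G" and v: "v \<in> verts H"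
  shows "clique_number_at H v = clique_number_at G v"
proof -
  have "clique H K \<longleftrightarrow> clique G K" if "v \<in> K" for K
    using clique_induce_iff[OF component_subset[OF H]] component_eq_induce[OF H]
      component_closed[OF H v] v that
    by (metis clique_def subsetI)
  then have "{card K |K. clique H K \<and> v \<in> K} = {card K |K. clique G K \<and> v \<in> K}" by blast
  then show ?thesis by (simp add: clique_number_at_def)
qed

lemma (in graph) component_dominates_iff:
  assumes H: "H \<in> components_of_graph G" and v: "v \<in> verts H"
  shows "v \<rightarrow>\<^bsub>H\<^esub> u \<longleftrightarrow> v \<rightarrow> u"
  using dominates_induce_iff[where S = "verts H" and u = v and v = u] component_eq_induce[OF H] component_closed[OF H v] v
  by auto

lemma (in graph) component_load:
  assumes H: "H \<in> components_of_graph G" and v: "v \<in> verts H"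
  shows "pre_digraph.load H k w v = load k w v"
proof -
  have "{u. u \<in> verts H \<and> v \<rightarrow>\<^bsub>H\<^esub> u} = {u. u \<in> verts G \<and> v \<rightarrow> u}"
    using component_dominates_iff[OF assms] component_closed[OF assms] component_subset[OF H]
    by auto
  then show ?thesis by (simp add: pre_digraph.load_def)
qed

text \<open>A maximum independent set splits into its traces on the components. Conversely,
  independent sets chosen in the components have an independent union, as no edge joins two
  components.\<close>

lemma (in graph) independence_number_components:
  "independence_number G = (\<Sum>H\<in>components_of_graph G. independence_number H)"
proof (rule antisym)
  obtain I where I: "independent_set G I" "card I = independence_number G"
    by (rule independence_number_attained)
  have "card I = (\<Sum>H\<in>components_of_graph G. card (I \<inter> verts H))"
    using sum_components[of I "\<lambda>_. 1::nat"] I(1) by (simp add: independent_set_def)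
  also have "\<dots> \<le> (\<Sum>H\<in>components_of_graph G. independence_number H)"
  proof (rule sum_mono)
    fix H assume H: "H \<in> components_of_graph G"
    interpret H: graph H by (rule component_graph[OF H])
    have "independent_set H (I \<inter> verts H)"
      using independent_induce_iff[OF component_subset[OF H], of "I \<inter> verts H"]
        component_eq_induce[OF H] I(1)
      by (auto simp: independent_set_def)
    then show "card (I \<inter> verts H) \<le> independence_number H" by (rule H.card_le_independence_number)
  qed
  finally show "independence_number G \<le> \<dots>" by (simp add: I(2))
next
  have "\<exists>I. independent_set H I \<and> card I = independence_number H"
    if "H \<in> components_of_graph G" for H
    using graph.independence_number_attained[OF component_graph[OF that]] by metis
  then obtain I where I: "\<And>H. H \<in> components_of_graph G \<Longrightarrow> independent_set H (I H)"
    "\<And>H. H \<in> components_of_graph G \<Longrightarrow> card (I H) = independence_number H"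
    by metis
  have sub: "I H \<subseteq> verts H" if "H \<in> components_of_graph G" for H
    using I(1)[OF that] by (simp add: independent_set_def)
  let ?J = "\<Union>H\<in>components_of_graph G. I H"
  have "independent_set G ?J"
    unfolding independent_set_def
  proof (intro conjI ballI)
    show "?J \<subseteq> verts G" using sub component_subset by blast
    fix u v assume "u \<in> ?J" "v \<in> ?J"
    then obtain H H' where H: "H \<in> components_of_graph G" "u \<in> I H"
      and H': "H' \<in> components_of_graph G" "v \<in> I H'" by blast
    show "\<not> u \<rightarrow> v"
    proof
      assume uv: "u \<rightarrow> v"
      then have "v \<in> verts H" using component_closed H sub by blast
      then have "H = H'" using components_disjoint H H' sub by blast
      moreover have "u \<rightarrow>\<^bsub>H\<^esub> v" using component_dominates_iff H sub uv by blast
      ultimately show False using I(1)[OF H(1)] H H' by (auto simp: independent_set_def)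
    qed
  qed
  moreover have "card ?J = (\<Sum>H\<in>components_of_graph G. card (I H))"
  proof (rule card_UN_disjoint[OF finite_components])
    show "\<forall>H\<in>components_of_graph G. finite (I H)"
      using sub component_subset finite_subset[OF _ finite_verts] by blast
    show "\<forall>H\<in>components_of_graph G. \<forall>H'\<in>components_of_graph G. H \<noteq> H' \<longrightarrow> I H \<inter> I H' = {}"
      using sub components_disjoint by blast
  qed
  ultimately show "(\<Sum>H\<in>components_of_graph G. independence_number H) \<le> independence_number G"
    using card_le_independence_number[of ?J] I(2) by simp
qed

section \<open>The equality case, component by component\<close>

text \<open>The loads over any heaviest set add up to \<open>independence_number G * l\<close>, so
  the assumption on \<open>l\<close> says that the counting inequality is tight for all of them. The
  conclusions supply conditions (ii), (iii) and (iv) of the equality case.\<close>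

lemma (in graph) constant_load_tight:
  fixes k w l
  assumes w: "\<And>v. v \<in> verts G \<Longrightarrow> 0 < w v"
    and k: "\<And>v. v \<in> verts G \<Longrightarrow> clique_number_at G v \<le> k v"
    and load: "\<And>v. v \<in> verts G \<Longrightarrow> load k w v = l"
    and l: "real (independence_number G) * l = 2 * sum w (verts G)"
    and H: "H \<in> components_of_graph G"
  shows "\<forall>v\<in>verts H. k v = clique_number_at H v \<and> clique_number_at H v = clique_number H"
    and "\<exists>d. regular_graph d H
          \<and> independence_number H * (d + clique_number H + 1) = 2 * card (verts H)"
    and "\<forall>v\<in>verts H. 2 * real (card (verts H)) * w v = real (independence_number H) * l"
proof -
  interpret tight_graph G k w
  proof
    fix I assume I: "heaviest w I"
    then have "I \<subseteq> verts G" and "card I = independence_number G"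
      by (auto simp: heaviest_def independent_set_def)
    moreover from this have "(\<Sum>v\<in>I. load k w v) = (\<Sum>v\<in>I. l)"
      using load by (intro sum.cong) auto
    ultimately show "(\<Sum>v\<in>I. load k w v) \<le> 2 * sum w (verts G)" using l by simp
  qed (use w k in auto)
  have ge: "2 * sum w (verts H) \<le> real (independence_number H) * l"
    if H: "H \<in> components_of_graph G" for H
  proof -
    interpret H: graph H by (rule component_graph[OF H])
    have sub: "v \<in> verts G" if "v \<in> verts H" for v using component_subset[OF H] that by blast
    obtain I where I: "H.heaviest w I" by (rule H.heaviest_exists)
    have "2 * sum w (verts H) \<le> (\<Sum>v\<in>I. H.load k w v)"
      using H.sum_load_ge[OF I] sub w k component_clique_number_at[OF H] by (simp add: less_imp_le)
    also have "\<dots> = (\<Sum>v\<in>I. l)"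
    proof (rule sum.cong[OF refl])
      fix v assume "v \<in> I"
      then have "v \<in> verts H" using I by (auto simp: H.heaviest_def independent_set_def)
      then show "H.load k w v = l" using component_load[OF H] load sub by simp
    qed
    also have "\<dots> = real (independence_number H) * l" using I by (simp add: H.heaviest_def)
    finally show ?thesis .
  qed
  \<comment> \<open>Independence number and weight are both additive over components, so the
    inequalities \<open>ge\<close> sum to an equality and each of them must be tight.\<close>
  have "(\<Sum>H\<in>components_of_graph G. real (independence_number H) * l - 2 * sum w (verts H)) = 0"
  proof -
    have "(\<Sum>H\<in>components_of_graph G. sum w (verts H))
        = (\<Sum>H\<in>components_of_graph G. sum w (verts G \<inter> verts H))"
      using component_subset by (intro sum.cong) (auto simp: Int_absorb1)
    then show ?thesis
      using l sum_components[of "verts G" w] independence_number_components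
      by (simp add: sum_subtractf sum_distrib_left[symmetric] sum_distrib_right[symmetric])
  qed
  then have eqH: "real (independence_number H) * l = 2 * sum w (verts H)"
    using H ge sum_nonneg_eq_0_iff[OF finite_components,
        of "\<lambda>H. real (independence_number H) * l - 2 * sum w (verts H)"]
    by simp
  interpret H: graph H by (rule component_graph[OF H])
  have sub: "v \<in> verts G" if "v \<in> verts H" for v using component_subset[OF H] that by blast
  obtain a where a: "a \<in> verts H" using component_nonempty[OF H] by blast
  have wa: "w v = w a" if "v \<in> verts H" for v
    using component_const[OF H, where f = w, OF tight_edge_eq(1) that a] .
  have ca: "clique_number_at H v = clique_number_at H a" if "v \<in> verts H" for v
    using component_const[OF H, where f = "clique_number_at G", OF tight_edge_eq(2) that a] component_clique_number_at[OF H] that a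
    by simp
  have om: "clique_number H = clique_number_at H a"
  proof (rule antisym)
    obtain K where K: "clique H K" "card K = clique_number H" by (rule H.clique_number_attained)
    show "clique_number H \<le> clique_number_at H a"
    proof (cases "K = {}")
      case False
      then obtain v where v: "v \<in> K" by blast
      then have "v \<in> verts H" using K(1) by (auto simp: clique_def)
      then show ?thesis using H.card_le_clique_number_at[OF K(1) v] K(2) ca[of v] by simp
    qed (use K in simp)
    obtain K where "clique H K" "card K = clique_number_at H a"
      using H.clique_number_at_attained[OF a] by blast
    then show "clique_number_at H a \<le> clique_number H" using H.card_le_clique_number[of K] by simp
  qed
  show A: "\<forall>v\<in>verts H. k v = clique_number_at H v \<and> clique_number_at H v = clique_number H"
    using om ca tight_k_eq sub component_clique_number_at[OF H] by simp
  have sumw: "sum w (verts H) = real (card (verts H)) * w a" using wa by simp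
  show "\<forall>v\<in>verts H. 2 * real (card (verts H)) * w v = real (independence_number H) * l"
    using eqH sumw wa by (simp add: algebra_simps)
  \<comment> \<open>With constant weight on \<open>H\<close> the load at \<open>v\<close> depends on
    \<open>v\<close> through its degree only; constant load then makes \<open>H\<close>
    regular.\<close>
  have deg: "(real (clique_number H) + 1 + real (out_degree H v)) * w a = l"
    if v: "v \<in> verts H" for v
  proof -
    have "(\<Sum>u | u \<in> verts H \<and> v \<rightarrow>\<^bsub>H\<^esub> u. w u) = (\<Sum>u | u \<in> verts H \<and> v \<rightarrow>\<^bsub>H\<^esub> u. w a)"
      by (intro sum.cong) (auto simp: wa)
    then have "H.load k w v = (real (clique_number H) + 1 + real (out_degree H v)) * w a"
      using A v wa[OF v] by (simp add: H.load_def H.out_degree_eq algebra_simps)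
    then show ?thesis using component_load[OF H v] load[OF sub[OF v]] by simp
  qed
  have w0: "0 < w a" using w sub a by simp
  have "out_degree H v = out_degree H a" if "v \<in> verts H" for v
    using trans[OF deg[OF that] deg[OF a, symmetric]] w0 by simp
  then have "regular_graph (out_degree H a) H" by (simp add: regular_graph_def)
  moreover have "real (independence_number H) * (real (out_degree H a) + clique_number H + 1) * w a
      = 2 * real (card (verts H)) * w a"
  proof -
    have "real (independence_number H) * (real (out_degree H a) + clique_number H + 1) * w a
      = real (independence_number H) * ((real (clique_number H) + 1 + real (out_degree H a)) * w a)"
      by (simp add: algebra_simps)
    then show ?thesis using eqH sumw deg[OF a] by simp
  qed
  then have "real (independence_number H) * (real (out_degree H a) + clique_number H + 1)
      = 2 * real (card (verts H))"
    using w0 by simp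
  then have "real (independence_number H * (out_degree H a + clique_number H + 1))
      = real (2 * card (verts H))"
    by (simp add: algebra_simps)
  then have "independence_number H * (out_degree H a + clique_number H + 1) = 2 * card (verts H)"
    by (rule of_nat_eq_iff[THEN iffD1])
  ultimately show "\<exists>d. regular_graph d H
          \<and> independence_number H * (d + clique_number H + 1) = 2 * card (verts H)" by blast
qed

section \<open>Minimizing the quadratic form on the simplex\<close>

lemma compact_standard_simplex: "compact (standard_simplex :: (real ^ 'n) set)"
proof -
  have "closed (standard_simplex :: (real ^ 'n) set)"
    unfolding standard_simplex_def
    by (intro closed_Collect_conj closed_Collect_all closed_Collect_eq closed_Collect_le
        continuous_intros)
  moreover have "norm x \<le> 1" if "x \<in> standard_simplex" for x :: "real ^ 'n"
    using norm_le_l1_cart[of x] that by (simp add: standard_simplex_def)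
  then have "bounded (standard_simplex :: (real ^ 'n) set)" by (auto intro: boundedI)
  ultimately show ?thesis by (simp add: compact_eq_bounded_closed)
qed

lemma quadratic_form_attains_min_on_simplex:
  fixes M :: "real ^ 'n ^ 'n"
  obtains x where "x \<in> standard_simplex"
    "\<And>y. y \<in> standard_simplex \<Longrightarrow> x \<bullet> (M *v x) \<le> y \<bullet> (M *v y)"
proof -
  \<comment> \<open>A corner of the simplex at an arbitrary index, as a witness that the simplex is
    nonempty.\<close>
  have "axis undefined 1 \<in> (standard_simplex :: (real ^ 'n) set)"
    by (simp add: standard_simplex_def axis_def)
  moreover have "continuous_on standard_simplex (\<lambda>x. x \<bullet> (M *v x))"
    by (intro continuous_intros linear_continuous_on_compose matrix_vector_mul_linear)
  ultimately show ?thesis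
    using continuous_attains_inf[OF compact_standard_simplex] that by blast
qed

text \<open>First-order optimality: if an entry of \<open>M *v x\<close> were below the minimum,
  moving \<open>x\<close> slightly towards the corresponding corner would decrease the form.\<close>

lemma quadratic_form_simplex_stationary:
  fixes M :: "real ^ 'n ^ 'n"
  assumes sym: "transpose M = M" and x: "x \<in> standard_simplex"
    and min: "\<And>y. y \<in> standard_simplex \<Longrightarrow> x \<bullet> (M *v x) \<le> y \<bullet> (M *v y)"
    and v: "v \<in> supp x"
  shows "(M *v x) $ v = x \<bullet> (M *v x)"
proof -
  let ?f = "x \<bullet> (M *v x)"
  have x0: "0 \<le> x $ u" and x1: "(\<Sum>u\<in>UNIV. x $ u) = 1" for u
    using x by (auto simp: standard_simplex_def)
  have ge: "?f \<le> (M *v x) $ u" for u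
  proof (rule ccontr)
    assume neg: "\<not> ?thesis"
    \<comment> \<open>\<open>e\<close> points from \<open>x\<close> to the corner \<open>u\<close>;
      a step of length \<open>t\<close> along it changes the form by
      \<open>t * (2 * a + t * b)\<close>.\<close>
    define e where "e = axis u 1 - x"
    define a where "a = (M *v x) $ u - ?f"
    define b where "b = e \<bullet> (M *v e)"
    have a: "e \<bullet> (M *v x) = a" by (simp add: e_def a_def inner_diff_left inner_axis')
    have a': "x \<bullet> (M *v e) = a"
      using a sym by (metis dot_lmul_matrix inner_commute transpose_matrix_vector)
    \<comment> \<open>Small enough for the linear term to win: \<open>t * b \<le> - a\<close> gives
      \<open>2 * a + t * b \<le> a < 0\<close>. The cap 1 keeps the new point in the simplex, and
      adding 1 to \<open>\<bar>b\<bar>\<close> avoids a zero denominator.\<close>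
    define t where "t = min 1 (- a / (\<bar>b\<bar> + 1))"
    have a0: "a < 0" using neg by (simp add: a_def)
    then have t: "0 < t" "t \<le> 1" by (auto simp: t_def intro: divide_neg_pos)
    have "t * (\<bar>b\<bar> + 1) \<le> - a"
      using mult_right_mono[of t "- a / (\<bar>b\<bar> + 1)" "\<bar>b\<bar> + 1"] by (simp add: t_def)
    moreover have "t * b \<le> t * (\<bar>b\<bar> + 1)" using t by (intro mult_left_mono) auto
    ultimately have "2 * a + t * b < 0" using a0 by linarith
    then have "t * (2 * a + t * b) < 0" using t by (simp add: mult_pos_neg)
    moreover have "x + t *\<^sub>R e \<in> standard_simplex"
    proof -
      have "x $ i + t * ((axis u 1 :: real ^ 'n) $ i - x $ i) \<ge> 0" for i
      proof -
        have "0 \<le> (1 - t) * x $ i + t * (axis u 1 :: real ^ 'n) $ i"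
          using t x0 by (intro add_nonneg_nonneg mult_nonneg_nonneg) (auto simp: axis_def)
        then show ?thesis by (simp add: algebra_simps)
      qed
      moreover have "(\<Sum>i\<in>UNIV. (axis u 1 :: real ^ 'n) $ i) = 1" by (simp add: axis_def)
      ultimately show ?thesis
        using x1 by (simp add: standard_simplex_def e_def sum.distrib sum_subtractf
            flip: sum_distrib_left)
    qed
    then have "?f \<le> (x + t *\<^sub>R e) \<bullet> (M *v (x + t *\<^sub>R e))" by (rule min)
    moreover have "(x + t *\<^sub>R e) \<bullet> (M *v (x + t *\<^sub>R e)) = ?f + t * (2 * a + t * b)"
      using a a' by (simp add: matrix_vector_right_distrib matrix_vector_mult_scaleR b_def
          inner_add_left inner_add_right algebra_simps)
    ultimately show False by linarith
  qed
  \<comment> \<open>The entries of \<open>M *v x\<close>, weighted by \<open>x\<close>, average to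
    \<open>?f\<close>; as none is smaller, those on the support equal it.\<close>
  have "(\<Sum>u\<in>UNIV. x $ u * ((M *v x) $ u - ?f)) = 0"
    using x1 by (simp add: right_diff_distrib sum_subtractf inner_vec_def flip: sum_distrib_right)
  then have "\<forall>u\<in>UNIV. x $ u * ((M *v x) $ u - ?f) = 0"
    using ge x0 by (subst (asm) sum_nonneg_eq_0_iff) auto
  then show ?thesis using v by (auto simp: supp_def)
qed

lemma sum_supp:
  assumes "x \<in> standard_simplex" shows "(\<Sum>v\<in>supp x. x $ v) = 1"
proof -
  have "(\<Sum>v\<in>supp x. x $ v) = (\<Sum>v\<in>UNIV. x $ v)"
    by (rule sum.mono_neutral_left) (auto simp: supp_def)
  then show ?thesis using assms by (simp add: standard_simplex_def)
qed

lemma inner_eq_of_const_on_supp: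
  assumes "x \<in> standard_simplex" "\<And>v. v \<in> supp x \<Longrightarrow> y $ v = l"
  shows "x \<bullet> y = l"
proof -
  have "x \<bullet> y = (\<Sum>v\<in>supp x. x $ v * y $ v)"
    unfolding inner_vec_def inner_real_def by (rule sum.mono_neutral_right) (auto simp: supp_def)
  also have "\<dots> = (\<Sum>v\<in>supp x. x $ v * l)" using assms(2) by simp
  finally show ?thesis using sum_supp[OF assms(1)] by (simp flip: sum_distrib_right)
qed

section \<open>The matrix of the theorem and the graph induced on the support\<close>

definition form_matrix :: "('n::finite, 'b) pre_digraph \<Rightarrow> real ^ 'n ^ 'n" where
  "form_matrix G = mat 1 + clique_matrix G + adjacency_matrix G"

lemma transpose_form_matrix:
  fixes G :: "('n::finite, 'b) pre_digraph"
  assumes "graph G" shows "transpose (form_matrix G) = form_matrix G"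
  using graph.adj_sym[OF assms]
  by (auto simp: form_matrix_def clique_matrix_def adjacency_matrix_def mat_def transpose_def
      vec_eq_iff)

text \<open>Since \<open>x\<close> vanishes off its support, the neighbour sum can be taken in the
  induced graph; the diagonal keeps the clique numbers of \<open>G\<close>.\<close>

lemma form_matrix_mult:
  fixes G :: "('n::finite, 'b) pre_digraph"
  assumes "graph G" "verts G = UNIV" "v \<in> supp x"
  shows "(form_matrix G *v x) $ v
    = pre_digraph.load (G \<restriction> supp x) (clique_number_at G) (\<lambda>v. x $ v) v"
proof -
  interpret graph G by fact
  have "(form_matrix G *v x) $ v
      = (\<Sum>u\<in>UNIV. (if u = v then (real (clique_number_at G v) + 1) * x $ v else 0)
          + (if v \<rightarrow>\<^bsub>G\<^esub> u then x $ u else 0))"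
    unfolding form_matrix_def matrix_vector_mult_def
    by (auto simp: clique_matrix_def adjacency_matrix_def mat_def algebra_simps intro!: sum.cong)
  also have "\<dots> = (real (clique_number_at G v) + 1) * x $ v + (\<Sum>u | v \<rightarrow>\<^bsub>G\<^esub> u. x $ u)"
    by (simp add: sum.distrib sum.If_cases)
  also have "(\<Sum>u | v \<rightarrow>\<^bsub>G\<^esub> u. x $ u) = (\<Sum>u | u \<in> supp x \<and> v \<rightarrow>\<^bsub>G \<restriction> supp x\<^esub> u. x $ u)"
    using assms(3) by (intro sum.mono_neutral_right) (auto simp: dominates_induce_iff supp_def)
  finally show ?thesis by (simp add: pre_digraph.load_def)
qed

text \<open>The clique numbers of \<open>G\<close> dominate those of the induced graph, so
  \<open>sum_load_ge\<close> applies there with \<open>k = clique_number_at G\<close> and total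
  weight 1.\<close>

lemma const_on_supp_bound:
  fixes G :: "('n::finite, 'b) pre_digraph"
  assumes "graph G" "verts G = UNIV" and x: "x \<in> standard_simplex"
    and l: "\<And>v. v \<in> supp x \<Longrightarrow> (form_matrix G *v x) $ v = l"
  shows "2 \<le> real (independence_number (G \<restriction> supp x)) * l"
proof -
  interpret graph G by fact
  interpret S: graph "G \<restriction> supp x" by (rule graph_induce) (simp add: assms)
  obtain I where I: "S.heaviest (\<lambda>v. x $ v) I" by (rule S.heaviest_exists)
  have "2 * (\<Sum>v\<in>supp x. x $ v) \<le> (\<Sum>v\<in>I. S.load (clique_number_at G) (\<lambda>v. x $ v) v)"
    using S.sum_load_ge[OF I, of "clique_number_at G"] x clique_number_at_induce_le[of "supp x"]
    by (simp add: standard_simplex_def assms(2))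
  also have "\<dots> = (\<Sum>v\<in>I. l)"
  proof (rule sum.cong[OF refl])
    fix v assume "v \<in> I"
    then have "v \<in> supp x" using I by (auto simp: S.heaviest_def independent_set_def)
    then show "S.load (clique_number_at G) (\<lambda>v. x $ v) v = l"
      using form_matrix_mult[OF assms(1,2)] l by simp
  qed
  also have "\<dots> = real (independence_number (G \<restriction> supp x)) * l"
    using I by (simp add: S.heaviest_def)
  finally show ?thesis using sum_supp[OF x] by simp
qed

text \<open>It suffices to treat a minimizer, where stationarity provides the constant entries that
  \<open>const_on_supp_bound\<close> asks for.\<close>

lemma form_lower_bound:
  fixes G :: "('n::finite, 'b) pre_digraph"
  assumes "graph G" "verts G = UNIV" "y \<in> standard_simplex"
  shows "2 / real (independence_number G) \<le> y \<bullet> (form_matrix G *v y)"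
proof -
  interpret graph G by fact
  obtain x where x: "x \<in> standard_simplex"
    and min: "\<And>y. y \<in> standard_simplex \<Longrightarrow> x \<bullet> (form_matrix G *v x) \<le> y \<bullet> (form_matrix G *v y)"
    using quadratic_form_attains_min_on_simplex[where M = "form_matrix G"] by blast
  let ?f = "x \<bullet> (form_matrix G *v x)"
  have two: "2 \<le> real (independence_number (G \<restriction> supp x)) * ?f"
    using const_on_supp_bound[OF assms(1,2) x]
      quadratic_form_simplex_stationary[OF transpose_form_matrix[OF assms(1)] x min] by blast
  \<comment> \<open>The sign is what permits replacing the independence number of the induced graph
    by the larger one of \<open>G\<close>.\<close>
  then have "0 \<le> ?f" by (smt (verit) of_nat_0_le_iff mult_nonneg_nonpos)
  then have "real (independence_number (G \<restriction> supp x)) * ?f \<le> real (independence_number G) * ?f"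
    using independence_number_induce_le[of "supp x"] assms(2) by (intro mult_right_mono) auto
  then have "2 \<le> real (independence_number G) * ?f" using two by linarith
  then have "2 / real (independence_number G) \<le> ?f"
    using independence_number_pos assms(2) by (simp add: field_simps)
  then show ?thesis using min[OF assms(3)] by linarith
qed

theorem theorem2p2:
  fixes G :: "('n::finite, 'b) pre_digraph" and x :: "real ^ 'n"
  assumes "graph G" and "verts G = UNIV" and "x \<in> standard_simplex"
  shows "x \<bullet> ((mat 1 + clique_matrix G + adjacency_matrix G) *v x)
           \<ge> 2 / real (independence_number G)
    \<and> (x \<bullet> ((mat 1 + clique_matrix G + adjacency_matrix G) *v x)
           = 2 / real (independence_number G)
        \<longleftrightarrow>
          (independence_number G = independence_number (G \<restriction> supp x)
            \<and> independence_number (G \<restriction> supp x)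
                = (\<Sum>H\<in>components_of_graph (G \<restriction> supp x). independence_number H))
        \<and> (\<forall>H\<in>components_of_graph (G \<restriction> supp x). \<forall>v\<in>verts H.
            clique_number_at G v = clique_number_at H v
            \<and> clique_number_at H v = clique_number H)
        \<and> (\<forall>H\<in>components_of_graph (G \<restriction> supp x). \<exists>d. regular_graph d H
            \<and> independence_number H * (d + clique_number H + 1) = 2 * card (verts H))
        \<and> (\<forall>H\<in>components_of_graph (G \<restriction> supp x). \<forall>v\<in>verts H.
            x $ v = real (independence_number H)
                      / (real (independence_number G) * real (card (verts H)))))"
    (is "?bound \<and> (?f = _ \<longleftrightarrow> ?i \<and> ?ii \<and> ?iii \<and> ?iv)")
proof -
  interpret graph G by fact
  interpret S: graph "G \<restriction> supp x" by (rule graph_induce) (simp add: assms)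
  define l where "l = 2 / real (independence_number G)"
  have f: "?f = x \<bullet> (form_matrix G *v x)" by (simp add: form_matrix_def)
  have al: "0 < real (independence_number G)" using independence_number_pos assms(2) by simp
  then have l: "0 < l" "real (independence_number G) * l = 2" by (auto simp: l_def)
  have ?bound using form_lower_bound[OF assms] f by simp
  moreover have "?i \<and> ?ii \<and> ?iii \<and> ?iv" if eq: "?f = l"
  proof -
    \<comment> \<open>Equality in the lower bound makes \<open>x\<close> itself a minimizer, hence
      stationary.\<close>
    have min: "x \<bullet> (form_matrix G *v x) \<le> y \<bullet> (form_matrix G *v y)"
      if "y \<in> standard_simplex" for y
      using form_lower_bound[OF assms(1,2) that] eq f by (simp add: l_def)
    have st: "(form_matrix G *v x) $ v = l" if "v \<in> supp x" for v
      using quadratic_form_simplex_stationary[OF transpose_form_matrix[OF assms(1)] assms(3) min that] eq f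
      by simp
    \<comment> \<open>The left side is 2, which is the lower bound for the right side obtained on
      the support; the other inequality between the independence numbers holds for any induced
      subgraph.\<close>
    have "real (independence_number G) * l \<le> real (independence_number (G \<restriction> supp x)) * l"
      using const_on_supp_bound[OF assms st] l by simp
    then have \<alpha>: "independence_number G = independence_number (G \<restriction> supp x)"
      using l(1) independence_number_induce_le[of "supp x"] assms(2) by simp
    then have ?i using S.independence_number_components by simp
    have pos: "0 < x $ v" if "v \<in> supp x" for v
      using that assms(3) unfolding supp_def standard_simplex_def
      by (metis (mono_tags, lifting) mem_Collect_eq order_le_less)
    have tot: "real (independence_number (G \<restriction> supp x)) * l = 2 * (\<Sum>v\<in>supp x. x $ v)"
      using \<alpha> l(2) sum_supp[OF assms(3)] by simp
    note tight = S.constant_load_tight[of "\<lambda>v. x $ v" "clique_number_at G" l]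
    have hyps: "\<And>v. v \<in> verts (G \<restriction> supp x) \<Longrightarrow> 0 < x $ v"
      "\<And>v. v \<in> verts (G \<restriction> supp x) \<Longrightarrow> clique_number_at (G \<restriction> supp x) v \<le> clique_number_at G v"
      "\<And>v. v \<in> verts (G \<restriction> supp x) \<Longrightarrow> S.load (clique_number_at G) (\<lambda>v. x $ v) v = l"
      "real (independence_number (G \<restriction> supp x)) * l = 2 * (\<Sum>v\<in>verts (G \<restriction> supp x). x $ v)"
      using pos clique_number_at_induce_le[of "supp x"] assms(2) tot st
        form_matrix_mult[OF assms(1,2)] by auto
    have ?ii using tight(1)[OF hyps] by blast
    moreover have ?iii using tight(2)[OF hyps] by blast
    moreover have ?iv
    proof (intro ballI)
      fix H v assume H: "H \<in> components_of_graph (G \<restriction> supp x)" and v: "v \<in> verts H"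
      interpret H: graph H by (rule S.component_graph[OF H])
      have "0 < real (card (verts H))" using v by (auto simp: card_gt_0_iff)
      then have nz: "real (independence_number G) * real (card (verts H)) \<noteq> 0"
        using mult_pos_pos[OF al] by (metis less_irrefl)
      have "2 * real (card (verts H)) * x $ v = real (independence_number H) * l"
        using tight(3)[OF hyps H] v by blast
      then have "x $ v * (real (independence_number G) * real (card (verts H)))
          = real (independence_number H)"
        using al by (simp add: l_def field_simps)
      then show "x $ v = real (independence_number H)
                      / (real (independence_number G) * real (card (verts H)))"
        by (simp only: nonzero_eq_divide_eq[OF nz])
    qed
    ultimately show ?thesis using \<open>?i\<close> by blast
  qed
  \<comment> \<open>Conversely, the conditions make every entry of \<open>form_matrix G *v x\<close>
    on the support equal to \<open>l\<close>, and the form is a weighted average of these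
    entries.\<close>
  moreover have "?f = l" if cond: "?ii \<and> ?iii \<and> ?iv"
    unfolding f
  proof (rule inner_eq_of_const_on_supp[OF assms(3)])
    fix v assume v: "v \<in> supp x"
    then obtain H where H: "H \<in> components_of_graph (G \<restriction> supp x)" and vH: "v \<in> verts H"
      using S.component_exists by auto
    interpret H: graph H by (rule S.component_graph[OF H])
    obtain d where d: "regular_graph d H"
      "independence_number H * (d + clique_number H + 1) = 2 * card (verts H)"
      using cond H by blast
    have x_eq: "x $ u = real (independence_number H)
        / (real (independence_number G) * real (card (verts H)))" if "u \<in> verts H" for u
      using cond H that by blast
    have k: "clique_number_at G v = clique_number H" using cond H vH by metis
    have "(\<Sum>u | u \<in> verts H \<and> v \<rightarrow>\<^bsub>H\<^esub> u. x $ u) = (\<Sum>u | u \<in> verts H \<and> v \<rightarrow>\<^bsub>H\<^esub> u. x $ v)"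
      by (intro sum.cong) (auto simp: x_eq vH)
    also have "\<dots> = real d * x $ v"
      using d(1) vH by (simp add: regular_graph_def H.out_degree_eq)
    finally have "H.load (clique_number_at G) (\<lambda>v. x $ v) v
        = real (d + clique_number H + 1) * x $ v"
      by (simp add: H.load_def k algebra_simps)
    also have "\<dots> = real (independence_number H * (d + clique_number H + 1))
        / (real (independence_number G) * real (card (verts H)))"
      unfolding x_eq[OF vH] of_nat_mult by (simp only: times_divide_eq_right mult.commute)
    \<comment> \<open>The numerator is \<open>2 * card (verts H)\<close> by the degree equation, so
      the size of \<open>H\<close> cancels.\<close>
    also have "\<dots> = l"
    proof -
      have "verts H \<noteq> {}" using vH by blast
      then show ?thesis using al unfolding d(2) by (simp add: l_def)
    qed
    finally show "(form_matrix G *v x) $ v = l"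
      using form_matrix_mult[OF assms(1,2) v] S.component_load[OF H vH] by simp
  qed
  ultimately show ?thesis unfolding l_def by blast
qed

end
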